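(* Let $p,q$ be positive integers, let $n=p+q+1$, let $a>1$ be a real number, and let $$S_{p,q}=\Big\{(x_1,\ldots,x_n)\in\mathbb{R}^n \;\Big|\; \Big(\sum_{i=1}^{p+1}x_i^2-a^2\Big)^2+\sum_{j=p+2}^{n}x_j^2=1\Big\}$$ with the subspace topology inherited from $\mathbb{R}^n$. Then $S_{p,q}$ is homeomorphic to the product of spheres $S^p\times S^q$.
   Context: $S^k$ denotes the standard $k$-dimensional sphere. *)

theory Defs
  imports "HOL-Analysis.Analysis"
begin

(* Euclidean_space n models R^n on functions nat => real vanishing from index n on, so the
   coordinate written x_i in 1-based notation is x (i - 1) here: x_1, ..., x_{p+1} are
   x 0, ..., x p, and x_{p+2}, ..., x_n with n = p + q + 1 are x (p + 1), ..., x (p + q). *)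
definition S_space :: "nat \<Rightarrow> nat \<Rightarrow> real \<Rightarrow> (nat \<Rightarrow> real) topology" where
  "S_space p q a =
     subtopology (Euclidean_space (p + q + 1))
       {x. ((\<Sum>i = 0..p. (x i)\<^sup>2) - a\<^sup>2)\<^sup>2 + (\<Sum>j = p + 1..p + q. (x j)\<^sup>2) = 1}"

end

theory Submission
  imports Defs
begin

text \<open>Put \<open>R = x\<^sub>1\<^sup>2 + \<dots> + x\<^bsub>p+1\<^esub>\<^sup>2\<close>. The defining equation says precisely that
  \<open>(R - a\<^sup>2, x\<^bsub>p+2\<^esub>, \<dots>, x\<^sub>n)\<close> is a unit vector of \<open>\<real>\<^bsup>q+1\<^esup>\<close>, and it constrains the first block
  \<open>(x\<^sub>1, \<dots>, x\<^bsub>p+1\<^esub>)\<close> only through its length. Hence \<open>\<bar>R - a\<^sup>2\<bar> \<le> 1\<close>, so \<open>a > 1\<close> forces \<open>R > 0\<close>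
  and the direction of the first block is a well-defined point of \<open>S\<^sup>p\<close>. The pair consisting of
  this direction and that unit vector determines \<open>x\<close>: the length of the first block is recovered
  as the square root of \<open>a\<^sup>2\<close> plus the leading coordinate of the unit vector. Both passages are
  continuous.\<close>

definition unit_sphere :: "nat \<Rightarrow> (nat \<Rightarrow> real) set" where
  "unit_sphere n = {x. (\<Sum>i\<le>n. (x i)\<^sup>2) = 1 \<and> (\<forall>i>n. x i = 0)}"

text \<open>The second block of coordinates is numbered from 1, so that it can follow the coordinate
  \<open>R - a\<^sup>2\<close> placed at index 0 of a point of \<open>S\<^sup>q\<close>.\<close>

definition S_set :: "nat \<Rightarrow> nat \<Rightarrow> real \<Rightarrow> (nat \<Rightarrow> real) set" where
  "S_set p q a = {x. ((\<Sum>i\<le>p. (x i)\<^sup>2) - a\<^sup>2)\<^sup>2 + (\<Sum>j=1..q. (x (p + j))\<^sup>2) = 1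
                     \<and> (\<forall>i>p + q. x i = 0)}"

definition split_map :: "nat \<Rightarrow> real \<Rightarrow> (nat \<Rightarrow> real) \<Rightarrow> (nat \<Rightarrow> real) \<times> (nat \<Rightarrow> real)" where
  "split_map p a x =
     ((\<lambda>i. if i \<le> p then x i / sqrt (\<Sum>i\<le>p. (x i)\<^sup>2) else 0),
      (\<lambda>j. if j = 0 then (\<Sum>i\<le>p. (x i)\<^sup>2) - a\<^sup>2 else x (p + j)))"

definition glue_map :: "nat \<Rightarrow> real \<Rightarrow> (nat \<Rightarrow> real) \<times> (nat \<Rightarrow> real) \<Rightarrow> nat \<Rightarrow> real" where
  "glue_map p a w = (\<lambda>i. if i \<le> p then fst w i * sqrt (a\<^sup>2 + snd w 0) else snd w (i - p))"

lemma nsphere_eq_top_of_set: "nsphere n = top_of_set (unit_sphere n)"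
  by (simp add: nsphere unit_sphere_def euclidean_product_topology)

lemma S_space_eq_top_of_set: "S_space p q a = top_of_set (S_set p q a)"
proof -
  have "(\<Sum>j = p + 1..p + q. (x j)\<^sup>2) = (\<Sum>j=1..q. (x (p + j))\<^sup>2)" for x :: "nat \<Rightarrow> real"
    using sum.shift_bounds_cl_nat_ivl[of "\<lambda>j. (x j)\<^sup>2" 1 p q] by (simp add: add.commute)
  then show ?thesis
    unfolding S_space_def S_set_def Euclidean_space_def subtopology_subtopology
      euclidean_product_topology
    by (intro arg_cong[of _ _ top_of_set])
       (auto simp: atMost_atLeast0 Suc_le_eq)
qed

lemma sum_atMost_split_first:
  fixes f :: "nat \<Rightarrow> 'a::comm_monoid_add"
  shows "sum f {..n} = f 0 + sum f {1..n}"
  by (simp add: atMost_atLeast0 sum.atLeast_Suc_atMost)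

text \<open>The only use of \<open>a > 1\<close> on the side of \<open>S\<^bsub>p,q\<^esub>\<close>: \<open>R\<close> differs from \<open>a\<^sup>2\<close> by at most 1, so the
  first block never vanishes and may be normalised.\<close>

lemma S_set_radius_pos:
  assumes "a > 1" and "x \<in> S_set p q a"
  shows "(\<Sum>i\<le>p. (x i)\<^sup>2) > 0"
proof -
  have "((\<Sum>i\<le>p. (x i)\<^sup>2) - a\<^sup>2)\<^sup>2 \<le> 1"
    using assms(2) sum_nonneg[of "{1..q}" "\<lambda>j. (x (p + j))\<^sup>2"] by (simp add: S_set_def)
  then have "\<bar>(\<Sum>i\<le>p. (x i)\<^sup>2) - a\<^sup>2\<bar> \<le> 1"
    by (simp add: abs_square_le_1)
  moreover have "a\<^sup>2 > 1"
    using assms(1) by simp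
  ultimately show ?thesis
    by linarith
qed

text \<open>The mirror image of the previous bound: the square of the intended radius of the first
  block, rebuilt from the leading coordinate of a unit vector, is positive.\<close>

lemma unit_sphere_radicand_pos:
  assumes "a > 1" and "v \<in> unit_sphere q"
  shows "a\<^sup>2 + v 0 > 0"
proof -
  have "(v 0)\<^sup>2 \<le> 1"
    using assms(2) sum_nonneg[of "{1..q}" "\<lambda>j. (v j)\<^sup>2"]
    by (simp add: unit_sphere_def sum_atMost_split_first)
  then have "\<bar>v 0\<bar> \<le> 1"
    by (simp add: abs_square_le_1)
  moreover have "a\<^sup>2 > 1"
    using assms(1) by simp
  ultimately show ?thesis
    by linarith
qed

lemma split_map_in_product:
  assumes "a > 1" and "x \<in> S_set p q a"
  shows "split_map p a x \<in> unit_sphere p \<times> unit_sphere q"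
proof -
  have "(\<Sum>i\<le>p. (x i / sqrt (\<Sum>i\<le>p. (x i)\<^sup>2))\<^sup>2) = 1"
    using S_set_radius_pos[OF assms]
    by (simp add: power_divide less_imp_le flip: sum_divide_distrib)
  then have "fst (split_map p a x) \<in> unit_sphere p"
    by (simp add: split_map_def unit_sphere_def cong: sum.cong_simp)
  moreover have "(\<Sum>j=1..q. (snd (split_map p a x) j)\<^sup>2) = (\<Sum>j=1..q. (x (p + j))\<^sup>2)"
    by (rule sum.cong) (auto simp: split_map_def)
  then have "snd (split_map p a x) \<in> unit_sphere q"
    using assms(2) unfolding unit_sphere_def sum_atMost_split_first[of _ q] mem_Collect_eq
    by (simp add: split_map_def S_set_def)
  ultimately show ?thesis
    by (simp add: mem_Times_iff)
qed

text \<open>Rescaling a unit vector multiplies its squared length by the radicand. This makes the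
  gluing map land in \<open>S\<^bsub>p,q\<^esub>\<close> and, as splitting divides by exactly this length, makes the two
  maps inverse to each other.\<close>

lemma glue_map_radius:
  assumes "a > 1" and "w \<in> unit_sphere p \<times> unit_sphere q"
  shows "(\<Sum>i\<le>p. (glue_map p a w i)\<^sup>2) = a\<^sup>2 + snd w 0"
proof -
  have "snd w \<in> unit_sphere q" and "fst w \<in> unit_sphere p"
    using assms(2) by auto
  with unit_sphere_radicand_pos[OF assms(1)] show ?thesis
    by (simp add: glue_map_def unit_sphere_def power_mult_distrib less_imp_le
        flip: sum_distrib_right)
qed

lemma glue_map_in_S_set:
  assumes "a > 1" and "w \<in> unit_sphere p \<times> unit_sphere q"
  shows "glue_map p a w \<in> S_set p q a"
proof -
  have "(\<Sum>j=1..q. (glue_map p a w (p + j))\<^sup>2) = (\<Sum>j=1..q. (snd w j)\<^sup>2)"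
    by (rule sum.cong) (auto simp: glue_map_def)
  then show ?thesis
    using assms(2) glue_map_radius[OF assms]
    by (auto simp: S_set_def unit_sphere_def sum_atMost_split_first[of _ q])
       (auto simp: glue_map_def)
qed

lemma glue_split:
  assumes "a > 1" and "x \<in> S_set p q a"
  shows "glue_map p a (split_map p a x) = x"
  using S_set_radius_pos[OF assms] by (auto simp: glue_map_def split_map_def fun_eq_iff)

lemma split_glue:
  assumes "a > 1" and "w \<in> unit_sphere p \<times> unit_sphere q"
  shows "split_map p a (glue_map p a w) = w"
proof -
  have "a\<^sup>2 + snd w 0 > 0"
    using unit_sphere_radicand_pos[OF assms(1)] assms(2) by auto
  moreover have "\<forall>i>p. fst w i = 0"
    using assms(2) by (auto simp: unit_sphere_def)
  ultimately show ?thesis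
    unfolding split_map_def glue_map_radius[OF assms]
    by (auto simp: prod_eq_iff glue_map_def)
qed

lemma continuous_on_split_map:
  assumes "a > 1"
  shows "continuous_on (S_set p q a) (split_map p a)"
proof -
  have coord: "continuous_on A (\<lambda>x. x i)" for A :: "(nat \<Rightarrow> real) set" and i
    by (rule continuous_on_product_then_coordinatewise) (rule continuous_on_id)
  have "continuous_on (S_set p q a) (\<lambda>x. x i / sqrt (\<Sum>i\<le>p. (x i)\<^sup>2))" for i
    by (intro continuous_intros coord) (auto dest: S_set_radius_pos[OF assms])
  then have "continuous_on (S_set p q a)
      (\<lambda>x. if i \<le> p then x i / sqrt (\<Sum>i\<le>p. (x i)\<^sup>2) else 0)" for i
    by (cases "i \<le> p") simp_all
  then have "continuous_on (S_set p q a)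
      (\<lambda>x i. if i \<le> p then x i / sqrt (\<Sum>i\<le>p. (x i)\<^sup>2) else 0)"
    by (rule continuous_on_coordinatewise_then_product)
  moreover have "continuous_on (S_set p q a)
      (\<lambda>x. if j = 0 then (\<Sum>i\<le>p. (x i)\<^sup>2) - a\<^sup>2 else x (p + j))" for j
    by (cases "j = 0") (simp_all, (intro continuous_intros coord)+)
  then have "continuous_on (S_set p q a)
      (\<lambda>x j. if j = 0 then (\<Sum>i\<le>p. (x i)\<^sup>2) - a\<^sup>2 else x (p + j))"
    by (rule continuous_on_coordinatewise_then_product)
  ultimately show ?thesis
    unfolding split_map_def by (rule continuous_on_Pair)
qed

lemma continuous_on_glue_map: "continuous_on A (glue_map p a)"
proof -
  have fst_coord: "continuous_on A (\<lambda>w. fst w i)" for i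
    by (rule continuous_on_product_then_coordinatewise) (intro continuous_intros)
  have snd_coord: "continuous_on A (\<lambda>w. snd w i)" for i
    by (rule continuous_on_product_then_coordinatewise) (intro continuous_intros)
  have scaled: "continuous_on A (\<lambda>w. fst w i * sqrt (a\<^sup>2 + snd w 0))" for i
    by (intro continuous_on_mult continuous_on_real_sqrt continuous_on_add continuous_on_const
        fst_coord snd_coord)
  have "continuous_on A
      (\<lambda>w. if i \<le> p then fst w i * sqrt (a\<^sup>2 + snd w 0) else snd w (i - p))" for i
    by (cases "i \<le> p") (simp_all add: scaled snd_coord)
  then show ?thesis
    unfolding glue_map_def by (rule continuous_on_coordinatewise_then_product)
qed

theorem mainTheorem1:
  fixes p q :: nat and a :: real
  assumes "p > 0" and "q > 0" and "a > 1"
  shows "S_space p q a homeomorphic_space prod_topology (nsphere p) (nsphere q)"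
proof -
  have "homeomorphic_maps (top_of_set (S_set p q a)) (top_of_set (unit_sphere p \<times> unit_sphere q))
          (split_map p a) (glue_map p a)"
    unfolding homeomorphic_maps_def continuous_map_subtopology_eu topspace_euclidean_subtopology
    by (intro conjI ballI continuous_on_split_map continuous_on_glue_map funcsetI assms(3)
        split_map_in_product glue_map_in_S_set glue_split split_glue)
  then show ?thesis
    unfolding S_space_eq_top_of_set nsphere_eq_top_of_set prod_topology_subtopology_eu
    by (rule homeomorphic_maps_imp_homeomorphic_space)
qed

end
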